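(* Let $n=2m$ be an even positive integer and let $A=[a_0,\dots,a_{n-1}]$, $B=[b_0,\dots,b_{n-1}]$, $C=[c_0,\dots,c_{n-1}]$, $D=[d_0,\dots,d_{n-1}]$ be a Williamson sequence of order $n$. Then $a_ib_ic_id_i=a_{i+m}b_{i+m}c_{i+m}d_{i+m}$ for all $0\le i<m$.
   Context: A sequence $X=[x_0,\dots,x_{n-1}]$ is symmetric if $x_i=x_{n-i}$ for $1\le i<n$. The periodic autocorrelation function of $X$ is $\mathrm{PAF}_X(s)=\sum_{k=0}^{n-1}x_kx_{(k+s)\bmod n}$. Four symmetric sequences $A,B,C,D\in\{\pm1\}^n$ form a Williamson sequence of order $n$ if $\mathrm{PAF}_A(s)+\mathrm{PAF}_B(s)+\mathrm{PAF}_C(s)+\mathrm{PAF}_D(s)=0$ for $s=1,\dots,\lfloor n/2\rfloor$. *)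

theory Defs
  imports Main
begin

definition symmetric_seq :: "int list \<Rightarrow> bool" where
  "symmetric_seq X \<longleftrightarrow> (\<forall>i. 1 \<le> i \<and> i < length X \<longrightarrow> X ! i = X ! (length X - i))"

definition PAF :: "int list \<Rightarrow> nat \<Rightarrow> int" where
  "PAF X s = (\<Sum>k<length X. X ! k * X ! ((k + s) mod length X))"

definition williamson :: "nat \<Rightarrow> int list \<Rightarrow> int list \<Rightarrow> int list \<Rightarrow> int list \<Rightarrow> bool" where
  "williamson n A B C D \<longleftrightarrow>
     (\<forall>X \<in> {A, B, C, D}. length X = n \<and> set X \<subseteq> {1, -1} \<and> symmetric_seq X) \<and>
     (\<forall>s \<in> {1..n div 2}. PAF A s + PAF B s + PAF C s + PAF D s = 0)"

end

theory Submission
  imports Defs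
begin

text \<open>
  Write every entry as \<open>1 - 2 p\<close> with \<open>p \<in> {0, 1}\<close>. The vanishing of the autocorrelations then says
  that \<open>\<Sum> p(k) p(k + s)\<close>, summed over \<open>k\<close> and over the four sequences, is congruent modulo 2 to
  the total number \<open>P\<close> of entries \<open>-1\<close>; for \<open>s = 0\<close> this is trivial. Since \<open>p(-k) = p(k)\<close>, the
  involution \<open>k \<mapsto> -k - s\<close> preserves the terms, so modulo 2 only its fixed points, the solutions of
  \<open>2k + s = 0\<close>, contribute. For \<open>s = 1\<close> there are none, hence \<open>P\<close> is even; for \<open>s = 2i\<close> they are
  \<open>-i\<close> and \<open>m - i\<close>, so the number of entries \<open>-1\<close> at the positions \<open>i\<close> and \<open>i + m\<close> is even.
\<close>

text \<open>Points moved by \<open>f\<close> form two-element orbits on which \<open>g\<close> is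
  constant. The linear order selects the smaller point of each orbit: \<open>f\<close> maps
  \<open>L\<close> bijectively onto \<open>G\<close>, so together they contribute twice
  \<open>sum g L\<close>.\<close>

lemma even_sum_involution:
  fixes g :: "'a::linorder \<Rightarrow> int"
  assumes "finite S"
    and f_in: "\<And>x. x \<in> S \<Longrightarrow> f x \<in> S"
    and f_f: "\<And>x. x \<in> S \<Longrightarrow> f (f x) = x"
    and g_f: "\<And>x. x \<in> S \<Longrightarrow> g (f x) = g x"
  shows "even (sum g S) \<longleftrightarrow> even (sum g {x \<in> S. f x = x})"
proof -
  define L where "L = {x \<in> S. x < f x}"
  define G where "G = {x \<in> S. f x < x}"
  have "S = {x \<in> S. f x = x} \<union> (L \<union> G)"
    by (auto simp: L_def G_def)
  then have "sum g S = sum g ({x \<in> S. f x = x} \<union> (L \<union> G))"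
    by simp
  also have "\<dots> = sum g {x \<in> S. f x = x} + (sum g L + sum g G)"
    using \<open>finite S\<close> by (subst sum.union_disjoint, auto simp: L_def G_def intro!: sum.union_disjoint)
  also have "sum g G = sum g L"
    by (rule sum.reindex_bij_witness[where i = f and j = f]) (auto simp: L_def G_def f_in f_f g_f)
  finally show ?thesis
    by simp
qed

lemma even_autocorrelation_iff:
  fixes p :: "int \<Rightarrow> int"
  assumes "n > 0"
    and periodic: "\<And>k. p (k mod n) = p k"
    and symmetric: "\<And>k. p (- k) = p k"
    and idem: "\<And>k. p k * p k = p k"
  shows "even (\<Sum>k\<in>{0..<n}. p k * p (k + s)) \<longleftrightarrow> even (\<Sum>k | k \<in> {0..<n} \<and> n dvd 2 * k + s. p k)"
proof -
  define f where "f k = (- k - s) mod n" for k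
  have p_f: "p (f k) = p (k + s)" for k
    using periodic[of "- k - s"] symmetric[of "k + s"] by (simp add: f_def)
  have p_f_s: "p (f k + s) = p k" for k
    using periodic[of "f k + s"] periodic[of "- k"] symmetric[of k]
    by (simp add: f_def mod_simps)
  have f_f: "f (f k) = k" if "k \<in> {0..<n}" for k
  proof -
    have "(- ((- k - s) mod n) - s) mod n = (- (- k - s) - s) mod n"
      by (metis mod_diff_left_eq mod_minus_eq)
    then show ?thesis
      using that by (simp add: f_def)
  qed
  have fixed: "f k = k \<longleftrightarrow> n dvd 2 * k + s" if "k \<in> {0..<n}" for k
  proof -
    have "f k = k \<longleftrightarrow> (- k - s) mod n = k mod n"
      using that by (simp add: f_def)
    also have "\<dots> \<longleftrightarrow> n dvd - (2 * k + s)"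
      by (simp add: mod_eq_dvd_iff algebra_simps)
    finally show ?thesis
      by (simp only: dvd_minus_iff)
  qed
  have "even (\<Sum>k\<in>{0..<n}. p k * p (k + s)) \<longleftrightarrow>
      even (\<Sum>k | k \<in> {0..<n} \<and> f k = k. p k * p (k + s))"
  proof (rule even_sum_involution)
    show "f k \<in> {0..<n}" for k
      using \<open>n > 0\<close> by (simp add: f_def)
  qed (simp_all add: f_f p_f p_f_s mult.commute)
  \<comment> \<open>At a fixed point \<open>p (k + s) = p (f k) = p k\<close>, and idempotence
    reduces the product to \<open>p k\<close>.\<close>
  also have "(\<Sum>k | k \<in> {0..<n} \<and> f k = k. p k * p (k + s)) = (\<Sum>k | k \<in> {0..<n} \<and> f k = k. p k)"
  proof (rule sum.cong[OF refl])
    fix k assume "k \<in> {k. k \<in> {0..<n} \<and> f k = k}"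
    then show "p k * p (k + s) = p k"
      using p_f[of k] idem[of k] by simp
  qed
  also have "{k. k \<in> {0..<n} \<and> f k = k} = {k. k \<in> {0..<n} \<and> n dvd 2 * k + s}"
    using fixed by blast
  finally show ?thesis .
qed

lemma even_autocorrelation_odd_shift:
  fixes p :: "int \<Rightarrow> int"
  assumes "n > 0" "even n" "odd s"
    and "\<And>k. p (k mod n) = p k" "\<And>k. p (- k) = p k" "\<And>k. p k * p k = p k"
  shows "even (\<Sum>k\<in>{0..<n}. p k * p (k + s))"
proof -
  have "\<not> n dvd 2 * k + s" for k
    using \<open>even n\<close> \<open>odd s\<close> by (meson dvd_trans dvd_triv_left even_add)
  then show ?thesis
    using even_autocorrelation_iff[of n p s] assms by simp
qed

lemma even_autocorrelation_even_shift_iff: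
  fixes p :: "int \<Rightarrow> int"
  assumes "m > 0"
    and periodic: "\<And>k. p (k mod (2 * m)) = p k"
    and symmetric: "\<And>k. p (- k) = p k"
    and "\<And>k. p k * p k = p k"
  shows "even (\<Sum>k\<in>{0..<2 * m}. p k * p (k + 2 * i)) \<longleftrightarrow> even (p i + p (i + m))"
proof -
  have "{k. k \<in> {0..<2 * m} \<and> 2 * m dvd 2 * k + 2 * i} =
      {(- i) mod (2 * m), (- (i + m)) mod (2 * m)}" (is "?F = ?R")
  proof
    show "?R \<subseteq> ?F"
    proof -
      have "2 * m dvd 2 * (j mod (2 * m)) + 2 * i" if "m dvd j + i" for j
      proof -
        have "j mod (2 * m) + i = (j + i) - m * (2 * (j div (2 * m)))"
          by (simp add: minus_mult_div_eq_mod[symmetric])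
        then have "m dvd j mod (2 * m) + i"
          using that by (metis dvd_diff dvd_triv_left)
        then show ?thesis
          by (metis distrib_left dvd_refl mult_dvd_mono)
      qed
      from this[of "- i"] this[of "- (i + m)"] \<open>m > 0\<close> show ?thesis
        by auto
    qed
    show "?F \<subseteq> ?R"
    proof
      fix k assume k: "k \<in> ?F"
      then have "2 * m dvd 2 * (k + i)"
        by (simp add: distrib_left)
      then have "m dvd k + i"
        by (simp only: dvd_mult_cancel_left) simp
      then obtain q where q: "k = - i + m * q"
        by (metis add_diff_cancel_left' add.commute add_uminus_conv_diff diff_add_cancel dvdE)
      have k_mod: "k = k mod (2 * m)"
        using k by simp
      show "k \<in> ?R"
      \<comment> \<open>Modulo \<open>2 * m\<close> only the parity of \<open>q\<close> matters. For
        odd \<open>q\<close> the residue of \<open>- i + m\<close> is written as that of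
        \<open>- (i + m)\<close>, so that \<open>symmetric\<close> can turn it into
        \<open>i + m\<close>.\<close>
      proof (cases "even q")
        case True
        then obtain r where "q = 2 * r" ..
        then have "k = - i + (2 * m) * r"
          using q by simp
        then show ?thesis
          using k_mod by (metis insertI1 mod_mult_self2)
      next
        case False
        then obtain r where "q = 2 * r + 1" by (rule oddE)
        then have "k = - (i + m) + (2 * m) * (r + 1)"
          using q by (simp add: algebra_simps)
        then show ?thesis
          using k_mod by (metis insertI1 insertI2 mod_mult_self2)
      qed
    qed
  qed
  \<comment> \<open>The two residues differ by \<open>m\<close> modulo \<open>2 * m\<close>, so they
    do not coincide and the sum really has two terms.\<close>
  moreover have "(- i) mod (2 * m) \<noteq> (- (i + m)) mod (2 * m)"
    using \<open>m > 0\<close> by (auto simp: mod_eq_dvd_iff dest: zdvd_imp_le)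
  ultimately have "(\<Sum>k | k \<in> {0..<2 * m} \<and> 2 * m dvd 2 * k + 2 * i. p k) = p i + p (i + m)"
    using periodic[of "- i"] periodic[of "- (i + m)"] symmetric[of i] symmetric[of "i + m"] by simp
  then show ?thesis
    using even_autocorrelation_iff[of "2 * m" p "2 * i"] assms by simp
qed

text \<open>The indicator of the entries \<open>- 1\<close> is extended periodically to all
  integers, so that negating or shifting an index needs no truncated subtraction.\<close>

definition neg_indicator :: "int list \<Rightarrow> int \<Rightarrow> int" where
  "neg_indicator X k = of_bool (X ! nat (k mod int (length X)) = - 1)"

lemma neg_indicator_mod: "neg_indicator X (k mod int (length X)) = neg_indicator X k"
  by (simp add: neg_indicator_def)

lemma neg_indicator_idem: "neg_indicator X k * neg_indicator X k = neg_indicator X k"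
  by (simp add: neg_indicator_def)

lemma neg_indicator_minus:
  assumes "symmetric_seq X" "X \<noteq> []"
  shows "neg_indicator X (- k) = neg_indicator X k"
\<comment> \<open>\<open>symmetric_seq\<close> speaks only of indices from 1 on; index 0 is its own
  negative modulo the length.\<close>
proof (cases "k mod int (length X) = 0")
  case True
  then show ?thesis
    by (auto simp: neg_indicator_def zmod_zminus1_eq_if)
next
  case False
  define j where "j = k mod int (length X)"
  have j: "0 < j" "j < int (length X)"
    using False \<open>X \<noteq> []\<close> pos_mod_sign[of "int (length X)" k] pos_mod_bound[of "int (length X)" k]
    by (simp_all add: j_def order_less_le)
  have "(- k) mod int (length X) = int (length X) - j"
    using False by (simp add: j_def zmod_zminus1_eq_if)
  moreover have "X ! nat j = X ! (length X - nat j)"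
    using assms j by (simp add: symmetric_seq_def)
  moreover have "nat (int (length X) - j) = length X - nat j"
    using j by (simp add: nat_diff_distrib)
  ultimately show ?thesis
    by (simp add: neg_indicator_def flip: j_def)
qed

lemma nth_eq_neg_indicator:
  assumes "set X \<subseteq> {1, - 1}" "k < length X"
  shows "X ! k = 1 - 2 * neg_indicator X (int k)"
  using subsetD[OF assms(1) nth_mem[OF assms(2)]] assms(2) by (auto simp: neg_indicator_def)

text \<open>Expanding \<open>(1 - 2 * p k) * (1 - 2 * p (k + int s))\<close> gives two linear sums,
  which agree because a shift permutes the residues. The factor 4 on both sums is later cancelled to
  compare them modulo 2.\<close>

lemma PAF_eq_neg_indicator:
  assumes "set X \<subseteq> {1, - 1}"
  defines "p \<equiv> neg_indicator X" and "n \<equiv> int (length X)"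
  shows "PAF X s = n - 4 * (\<Sum>k\<in>{0..<n}. p k) + 4 * (\<Sum>k\<in>{0..<n}. p k * p (k + int s))"
proof (cases "X = []")
  case True
  then show ?thesis
    by (simp add: PAF_def n_def)
next
  case False
  have shift: "(\<Sum>k\<in>{0..<n}. p (k + int s)) = (\<Sum>k\<in>{0..<n}. p k)"
  proof (rule sum.reindex_bij_witness[where i = "\<lambda>k. (k - int s) mod n" and j = "\<lambda>k. (k + int s) mod n"])
    show "p ((k + int s) mod n) = p (k + int s)" for k
      by (simp add: p_def n_def neg_indicator_mod)
  qed (use False in \<open>auto simp: mod_simps n_def\<close>)
  have "PAF X s = (\<Sum>k<length X. (1 - 2 * p (int k)) * (1 - 2 * p (int k + int s)))"
    unfolding PAF_def
  proof (rule sum.cong[OF refl])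
    fix k assume "k \<in> {..<length X}"
    then show "X ! k * X ! ((k + s) mod length X) = (1 - 2 * p (int k)) * (1 - 2 * p (int k + int s))"
      using False neg_indicator_mod[of X "int k + int s"]
      by (simp add: nth_eq_neg_indicator[OF assms(1)] p_def zmod_int)
  qed
  also have "\<dots> = (\<Sum>k\<in>{0..<n}. (1 - 2 * p k) * (1 - 2 * p (k + int s)))"
    by (rule sum.reindex_bij_witness[where i = nat and j = int]) (auto simp: n_def)
  also have "\<dots> = (\<Sum>k\<in>{0..<n}. 1 - 2 * p k - 2 * p (k + int s) + 4 * (p k * p (k + int s)))"
    by (simp add: algebra_simps)
  also have "\<dots> = n - 2 * (\<Sum>k\<in>{0..<n}. p k) - 2 * (\<Sum>k\<in>{0..<n}. p (k + int s))
      + 4 * (\<Sum>k\<in>{0..<n}. p k * p (k + int s))"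
    by (simp add: sum.distrib sum_subtractf n_def flip: sum_distrib_left)
  finally show ?thesis
    by (simp add: shift)
qed

text \<open>The bound \<open>2 * i \<le> m\<close> keeps the shift \<open>2 * i\<close> where a
  parity relation is available: the Williamson condition covers \<open>1..m\<close>, and shift 0 is
  trivial.\<close>

lemma even_total_neg_indicator:
  assumes "n > 0" "n = 2 * m" "williamson n A B C D" "2 * i \<le> m"
  defines "P \<equiv> \<lambda>k. neg_indicator A k + neg_indicator B k + neg_indicator C k + neg_indicator D k"
  shows "even (P (int i) + P (int i + int m))"
proof -
  define Q where "Q X s = (\<Sum>k\<in>{0..<int n}. neg_indicator X k * neg_indicator X (k + int s))"
    for X and s :: nat
  define N where "N X = (\<Sum>k\<in>{0..<int n}. neg_indicator X k)" for X
  have len: "length X = n" and entries: "set X \<subseteq> {1, - 1}" and symm: "symmetric_seq X" and ne: "X \<noteq> []"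
    if "X \<in> {A, B, C, D}" for X
    using assms(1,3) that unfolding williamson_def by (blast, blast, blast, force)
  have PAF: "PAF X s = int n - 4 * N X + 4 * Q X s" if "X \<in> {A, B, C, D}" for X s
    using PAF_eq_neg_indicator[OF entries[OF that]] len[OF that] by (simp add: N_def Q_def)
  have parity: "even (Q A s + Q B s + Q C s + Q D s) \<longleftrightarrow> even (N A + N B + N C + N D)"
    if "s \<le> m" for s
  proof (cases "s = 0")
    case True
    then show ?thesis
      by (simp add: Q_def N_def neg_indicator_idem)
  next
    case False
    then have "PAF A s + PAF B s + PAF C s + PAF D s = 0"
      using assms(2,3) that unfolding williamson_def by simp
    \<comment> \<open>The four copies of \<open>int n\<close> add up to \<open>4 * int n\<close>;
      cancelling 4 leaves \<open>int n = 2 * int m\<close>, which does not affect parity.\<close>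
    then have "Q A s + Q B s + Q C s + Q D s = N A + N B + N C + N D - 2 * int m"
      using assms(2) by (simp add: PAF)
    then show ?thesis
      by simp
  qed
  have mod: "neg_indicator X (k mod (2 * int m)) = neg_indicator X k" if "X \<in> {A, B, C, D}" for X k
    using neg_indicator_mod[of X k] len[OF that] assms(2) by simp
  have "even (Q X 1)" if "X \<in> {A, B, C, D}" for X
    unfolding Q_def
    by (rule even_autocorrelation_odd_shift)
      (use assms(1,2) mod[OF that] symm[OF that] ne[OF that] in
        \<open>simp_all add: neg_indicator_minus neg_indicator_idem\<close>)
  then have "even (Q A 1 + Q B 1 + Q C 1 + Q D 1)"
    by simp
  \<comment> \<open>Shift 1 is always in range, since \<open>n > 0\<close> forces
    \<open>m \<ge> 1\<close>.\<close>
  then have even_N: "even (N A + N B + N C + N D)"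
    using parity[of 1] assms(1,2) by simp
  have "even (Q X (2 * i)) \<longleftrightarrow> even (neg_indicator X (int i) + neg_indicator X (int i + int m))"
    if "X \<in> {A, B, C, D}" for X
    using even_autocorrelation_even_shift_iff[of "int m" "neg_indicator X" "int i"]
      assms(1,2) mod[OF that] symm[OF that] ne[OF that]
    by (simp add: Q_def neg_indicator_minus neg_indicator_idem)
  with even_N parity[OF \<open>2 * i \<le> m\<close>] show ?thesis
    by (simp add: P_def) blast
qed

theorem theorem5:
  fixes n m :: nat and A B C D :: "int list"
  assumes "n > 0" and "n = 2 * m"
    and "williamson n A B C D"
  shows "\<forall>i<m. A ! i * B ! i * C ! i * D ! i =
               A ! (i + m) * B ! (i + m) * C ! (i + m) * D ! (i + m)"
proof (intro allI impI)
  fix i assume i: "i < m"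
  define P where "P k = neg_indicator A k + neg_indicator B k + neg_indicator C k + neg_indicator D k"
    for k
  have len: "length X = n" and entries: "set X \<subseteq> {1, - 1}" and symm: "symmetric_seq X" and ne: "X \<noteq> []"
    if "X \<in> {A, B, C, D}" for X
    using assms(1,3) that unfolding williamson_def by (blast, blast, blast, force)
  have "even (P (int i) + P (int i + int m))"
  proof (cases "2 * i \<le> m")
    case True
    then show ?thesis
      using even_total_neg_indicator[OF assms] by (simp add: P_def)
  next
    case False
    \<comment> \<open>Negation modulo \<open>n\<close> sends \<open>i + m\<close> to
      \<open>m - i\<close> and \<open>i\<close> to \<open>(m - i) + m\<close>. By symmetry the claim
      for \<open>i\<close> is thus the claim for \<open>m - i\<close>, which lies in the range
      already treated.\<close>
    have reflect: "neg_indicator X (int (m - i)) = neg_indicator X (int i + int m)"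
      "neg_indicator X (int (m - i) + int m) = neg_indicator X (int i)" if "X \<in> {A, B, C, D}" for X
    proof -
      have "neg_indicator X (int n - k) = neg_indicator X k" for k
        using neg_indicator_minus[OF symm[OF that] ne[OF that], of k] neg_indicator_mod[of X "- k"]
          neg_indicator_mod[of X "int n - k"] len[OF that] by simp
      from this[of "int i + int m"] this[of "int i"] show
        "neg_indicator X (int (m - i)) = neg_indicator X (int i + int m)"
        "neg_indicator X (int (m - i) + int m) = neg_indicator X (int i)"
        using i assms(2) by (simp_all add: algebra_simps)
    qed
    have "2 * (m - i) \<le> m"
      using False by simp
    from even_total_neg_indicator[OF assms this]
    have "even (P (int (m - i)) + P (int (m - i) + int m))"
      by (simp add: P_def)
    also have "P (int (m - i)) = P (int i + int m)"
      by (simp add: P_def reflect)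
    also have "P (int (m - i) + int m) = P (int i)"
      by (simp add: P_def reflect)
    finally show ?thesis
      by (simp only: add.commute)
  qed
  \<comment> \<open>Each entry is \<open>- 1\<close> to the power of its indicator, so the product
    of the four depends only on the parity of \<open>P\<close>.\<close>
  moreover have "A ! k * B ! k * C ! k * D ! k = (if even (P (int k)) then 1 else - 1)"
    if "k < n" for k
  proof -
    have "X ! k = (if even (neg_indicator X (int k)) then 1 else - 1)" if "X \<in> {A, B, C, D}" for X
      using nth_eq_neg_indicator[OF entries[OF that], of k] len[OF that] \<open>k < n\<close>
      by (auto simp: neg_indicator_def split: if_splits)
    then show ?thesis
      by (simp add: P_def)
  qed
  ultimately show "A ! i * B ! i * C ! i * D ! i =
      A ! (i + m) * B ! (i + m) * C ! (i + m) * D ! (i + m)"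
    using i assms(2) by simp
qed

end
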